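(* For every integer $n\ge1$, in the polynomial ring $\mathbb{Z}[\lambda,x_1,\dots,x_n]$, \[\prod_{1\le i<j\le n}(x_i+\lambda x_j)=\sum_{\alpha\in Y_n^+(\{b,y,o,g\})}\lambda^{E(\alpha)}(1+\lambda)^{N(\alpha)}\prod_{k=1}^{n}x_k^{C_k(\alpha)-1}.\]
   Context: $Y_n^+(\{b,y,o,g\})$ is the set of integer arrays $\alpha=(\alpha_{i,j})$ indexed by $1\le i\le n$, $0\le j\le n-i$, such that $\alpha_{i,0}=i$ for all $i$, $i\le\alpha_{i,j}\le i+j$ for all entries, and, whenever both entries involved are defined: $\alpha_{i,j}<\alpha_{i+1,j}$, $\alpha_{i,j}\le\alpha_{i,j+1}$, and $\alpha_{i,j}\le\alpha_{i+1,j-1}$. For an entry $\alpha_{i,j}$ with $j\ge1$, its southwest neighbor is $\alpha_{i+1,j-1}$ and its west neighbor is $\alpha_{i,j-1}$. $E(\alpha)$ is the number of entries $\alpha_{i,j}$ ($j\ge1$) equal to their southwest neighbor; $N(\alpha)$ is the number of entries $\alpha_{i,j}$ ($j\ge1$) strictly greater than their west neighbor and strictly less than their southwest neighbor; $C_k(\alpha)$ is the total number of entries of $\alpha$ (including column $0$) equal to $k$. *)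

theory Defs
  imports Main "HOL-Library.FuncSet" "HOL-Library.Poly_Mapping"
begin

text \<open>
  Integer polynomials are finitely supported maps from monomials to coefficients, a monomial
  being a finitely supported map from variables to exponents. The variables are \<open>\<lambda>\<close> and all
  \<open>x\<^sub>k\<close> with \<open>k :: nat\<close>; the ring \<open>\<int>[\<lambda>, x\<^sub>1, \<dots>, x\<^sub>n]\<close> is the subring of the polynomials in
  which only \<open>\<lambda>\<close> and \<open>x\<^sub>1, \<dots>, x\<^sub>n\<close> occur.
\<close>

datatype var = Lam | X nat

type_synonym int_mpoly = "(var \<Rightarrow>\<^sub>0 nat) \<Rightarrow>\<^sub>0 int"

definition Var :: "var \<Rightarrow> int_mpoly" where
  "Var v = Poly_Mapping.single (Poly_Mapping.single v 1) 1"

abbreviation lam :: int_mpoly where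
  "lam \<equiv> Var Lam"

abbreviation xvar :: "nat \<Rightarrow> int_mpoly" where
  "xvar k \<equiv> Var (X k)"

definition positions :: "nat \<Rightarrow> (nat \<times> nat) set" where
  "positions n = {(i, j). 1 \<le> i \<and> i \<le> n \<and> j \<le> n - i}"

text \<open>
  An array is a function on positions; \<open>extensional\<close> fixes its value outside the index set, so
  that distinct elements of \<open>Yplus n\<close> are distinct arrays. The membership premises on neighbouring
  positions express that the entries involved are defined.
\<close>

definition Yplus :: "nat \<Rightarrow> (nat \<times> nat \<Rightarrow> int) set" where
  "Yplus n = {\<alpha> \<in> extensional (positions n).
     (\<forall>i. (i, 0) \<in> positions n \<longrightarrow> \<alpha> (i, 0) = int i) \<and>
     (\<forall>(i, j) \<in> positions n. int i \<le> \<alpha> (i, j) \<and> \<alpha> (i, j) \<le> int (i + j)) \<and>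
     (\<forall>(i, j) \<in> positions n. (i + 1, j) \<in> positions n \<longrightarrow> \<alpha> (i, j) < \<alpha> (i + 1, j)) \<and>
     (\<forall>(i, j) \<in> positions n. (i, j + 1) \<in> positions n \<longrightarrow> \<alpha> (i, j) \<le> \<alpha> (i, j + 1)) \<and>
     (\<forall>(i, j) \<in> positions n. 1 \<le> j \<and> (i + 1, j - 1) \<in> positions n
        \<longrightarrow> \<alpha> (i, j) \<le> \<alpha> (i + 1, j - 1))}"

definition E_stat :: "nat \<Rightarrow> (nat \<times> nat \<Rightarrow> int) \<Rightarrow> nat" where
  "E_stat n \<alpha> = card {(i, j). (i, j) \<in> positions n \<and> 1 \<le> j \<and> \<alpha> (i, j) = \<alpha> (i + 1, j - 1)}"

definition N_stat :: "nat \<Rightarrow> (nat \<times> nat \<Rightarrow> int) \<Rightarrow> nat" where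
  "N_stat n \<alpha> = card {(i, j). (i, j) \<in> positions n \<and> 1 \<le> j \<and>
     \<alpha> (i, j - 1) < \<alpha> (i, j) \<and> \<alpha> (i, j) < \<alpha> (i + 1, j - 1)}"

definition C_stat :: "nat \<Rightarrow> nat \<Rightarrow> (nat \<times> nat \<Rightarrow> int) \<Rightarrow> nat" where
  "C_stat n k \<alpha> = card {p \<in> positions n. \<alpha> p = int k}"

lemma finite_positions: "finite (positions n)"
  by (rule finite_subset[of _ "{..n} \<times> {..n}"]) (auto simp: positions_def)

lemma finite_Yplus: "finite (Yplus n)"
proof (rule finite_subset)
  show "Yplus n \<subseteq> (\<Pi>\<^sub>E (i, j) \<in> positions n. {int i..int (i + j)})"
    by (auto simp: Yplus_def PiE_def Pi_def)
  show "finite (\<Pi>\<^sub>E (i, j) \<in> positions n. {int i..int (i + j)})"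
    by (intro finite_PiE finite_positions) auto
qed

text \<open>Hence the exponent \<open>C_stat n k \<alpha> - 1\<close> involves no truncated subtraction.\<close>

lemma C_stat_pos:
  assumes "\<alpha> \<in> Yplus n" "1 \<le> k" "k \<le> n"
  shows "1 \<le> C_stat n k \<alpha>"
proof -
  have "(k, 0) \<in> {p \<in> positions n. \<alpha> p = int k}"
    using assms by (auto simp: Yplus_def positions_def)
  moreover have "finite {p \<in> positions n. \<alpha> p = int k}"
    using finite_positions by simp
  ultimately have "card {p \<in> positions n. \<alpha> p = int k} > 0"
    by (auto simp: card_gt_0_iff)
  then show ?thesis by (simp add: C_stat_def)
qed

end

theory Submission
  imports Defs "Jordan_Normal_Form.Determinant"
begin

text \<open>
  An array is a monotone triangle whose rows are the columns \<open>n - 1, \<dots>, 0\<close> of the array, the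
  last of them being \<open>1, \<dots>, n\<close>. Put
  \[U_t(z) = \prod_{s<t}(1 + z x_s)\prod_{s>t}(1 - \lambda z x_s).\]
  Telescoping \<open>U_b - U_a\<close> over \<open>a \<le> s \<le> b\<close> gives \<open>z\<close> times the sum of the \<open>x_s U_s\<close>,
  weighted by \<open>1\<close> at \<open>s = a\<close>, by \<open>\<lambda>\<close> at \<open>s = b\<close> and by \<open>1 + \<lambda>\<close> in between, which are exactly the
  local weights of an entry \<open>s\<close> between its west neighbor \<open>a\<close> and its southwest neighbor \<open>b\<close>.
  As the constant terms are \<open>1\<close>, subtracting consecutive rows in \<open>det [z^k] U_{t_i}\<close> removes one
  row and one column, and multilinearity expands the result into a sum over interlacing rows; the
  weakly increasing rows that are not strictly increasing contribute determinants with two equal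
  rows. So this determinant is the generating function of the triangles with bottom row \<open>t\<close>. For
  the bottom row \<open>1, \<dots>, n\<close>, the differences of consecutive rows are instead divisible by
  \<open>x_a + \<lambda> x_{a+1}\<close>; splitting this factor off and repeating the step evaluates the determinant
  as the product.
\<close>

section \<open>Determinants\<close>

text \<open>Subtracting from every row its predecessor is left multiplication by the unipotent
  matrix \<open>L\<close>. This turns column 0 into (1, 0, ..., 0), and Laplace expansion along it
  leaves a single minor.\<close>

lemma det_consecutive_row_differences:
  fixes f :: "nat \<Rightarrow> nat \<Rightarrow> 'a::comm_ring_1"
  assumes "\<And>i. i \<le> m \<Longrightarrow> f i 0 = 1"
  shows "det (mat (Suc m) (Suc m) (\<lambda>(i, k). f i k)) =
    det (mat m m (\<lambda>(i, k). f (Suc i) (Suc k) - f i (Suc k)))"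
proof -
  define L :: "'a mat" where
    "L = mat (Suc m) (Suc m) (\<lambda>(i, j). if i = j then 1 else if i = Suc j then - 1 else 0)"
  define A where "A = mat (Suc m) (Suc m) (\<lambda>(i, k). f i k)"
  define B where
    "B = mat (Suc m) (Suc m) (\<lambda>(i, k). if i = 0 then f i k else f i k - f (i - 1) k)"
  have carrier: "L \<in> carrier_mat (Suc m) (Suc m)" "A \<in> carrier_mat (Suc m) (Suc m)"
    "B \<in> carrier_mat (Suc m) (Suc m)"
    by (simp_all add: L_def A_def B_def)
  have "det L = prod_list (diag_mat L)"
    by (rule det_lower_triangular[OF _ carrier(1)]) (auto simp: L_def)
  also have "diag_mat L = replicate (Suc m) 1"
    by (rule nth_equalityI) (auto simp: L_def diag_mat_def simp del: upt_Suc replicate_Suc)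
  finally have "det L = 1"
    by simp
  have "L * A = B"
  proof (rule eq_matI)
    fix i k assume "i < dim_row B" "k < dim_col B"
    then have i: "i < Suc m" and k: "k < Suc m"
      by (auto simp: B_def)
    have "(L * A) $$ (i, k) =
        (\<Sum>j\<in>{0..<Suc m}. (if i = j then 1 else if i = Suc j then - 1 else 0) * f j k)"
      using i k by (simp add: L_def A_def scalar_prod_def del: sum.op_ivl_Suc)
    \<comment> \<open>Row \<open>i\<close> of \<open>L\<close> vanishes outside the columns
      \<open>i\<close> and \<open>i - 1\<close>; row 0 has only its diagonal entry.\<close>
    also have "\<dots> = (\<Sum>j\<in>(if i = 0 then {0} else {i, i - 1}).
        (if i = j then 1 else if i = Suc j then - 1 else 0) * f j k)"
      using i by (intro sum.mono_neutral_right) auto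
    also have "\<dots> = B $$ (i, k)"
      using i k by (auto simp: B_def)
    finally show "(L * A) $$ (i, k) = B $$ (i, k)" .
  qed (use carrier in auto)
  then have "det A = det B"
    using det_mult[OF carrier(1,2)] \<open>det L = 1\<close> by simp
  also have "\<dots> = (\<Sum>i<Suc m. B $$ (i, 0) * cofactor B i 0)"
    by (rule laplace_expansion_column[OF carrier(3)]) simp
  also have "\<dots> = (\<Sum>i\<in>{0}. B $$ (i, 0) * cofactor B i 0)"
    using assms by (intro sum.mono_neutral_right) (auto simp: B_def)
  also have "\<dots> = det (mat_delete B 0 0)"
    using assms by (simp add: cofactor_def B_def)
  also have "mat_delete B 0 0 = mat m m (\<lambda>(i, k). f (Suc i) (Suc k) - f i (Suc k))"
    by (rule eq_matI) (auto simp: mat_delete_def B_def)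
  finally show ?thesis
    by (simp add: A_def)
qed

lemma det_scale_rows:
  fixes f :: "nat \<Rightarrow> nat \<Rightarrow> 'a::comm_ring_1"
  shows "det (mat m m (\<lambda>(i, k). c i * f i k)) = (\<Prod>i<m. c i) * det (mat m m (\<lambda>(i, k). f i k))"
proof -
  have "(\<Prod>i = 0..<m. mat m m (\<lambda>(i, k). c i * f i k) $$ (i, p i)) =
      (\<Prod>i<m. c i) * (\<Prod>i = 0..<m. mat m m (\<lambda>(i, k). f i k) $$ (i, p i))"
    if "p permutes {0..<m}" for p
    using permutes_in_image[OF that]
    by (auto simp: prod.distrib[symmetric] lessThan_atLeast0 intro!: prod.cong)
  then show ?thesis
    by (subst (1 2) det_def') (auto simp: sum_distrib_left mult_ac intro!: sum.cong)
qed

text \<open>Multilinearity in the rows: in the Leibniz formula the product of row sums is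
  distributed over all choice functions \<open>\<sigma>\<close>, and the two sums are swapped.
  Choice functions live on \<open>{1..m}\<close>, like the rows of a triangle, while matrix rows
  start at 0; hence \<open>Suc i\<close>.\<close>

lemma det_sum_rows:
  fixes f :: "'b \<Rightarrow> nat \<Rightarrow> 'a::comm_ring_1"
  assumes "\<And>i. i \<in> {1..m} \<Longrightarrow> finite (S i)"
  shows "det (mat m m (\<lambda>(i, k). \<Sum>s\<in>S (Suc i). c (Suc i) s * f s k)) =
    (\<Sum>\<sigma>\<in>Pi\<^sub>E {1..m} S. (\<Prod>i\<in>{1..m}. c i (\<sigma> i)) * det (mat m m (\<lambda>(i, k). f (\<sigma> (Suc i)) k)))"
proof -
  have shift: "(\<Prod>i = 0..<m. g (Suc i)) = (\<Prod>i\<in>{1..m}. g i)" for g :: "nat \<Rightarrow> 'a"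
    by (simp add: prod.shift_bounds_Suc_ivl[symmetric] atLeastLessThanSuc_atLeastAtMost)
  have expand: "(\<Prod>i = 0..<m. mat m m (\<lambda>(i, k). \<Sum>s\<in>S (Suc i). c (Suc i) s * f s k) $$ (i, p i)) =
      (\<Sum>\<sigma>\<in>Pi\<^sub>E {1..m} S. (\<Prod>i\<in>{1..m}. c i (\<sigma> i)) *
        (\<Prod>i = 0..<m. mat m m (\<lambda>(i, k). f (\<sigma> (Suc i)) k) $$ (i, p i)))"
    if "p permutes {0..<m}" for p
  proof -
    have p: "p i < m" if "i < m" for i
      using permutes_in_image[OF \<open>p permutes {0..<m}\<close>, of i] that by simp
    \<comment> \<open>Writing \<open>p i\<close> as \<open>p (Suc i - 1)\<close> makes every factor
      a function of \<open>Suc i\<close>, so that \<open>shift\<close> applies.\<close>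
    have "(\<Prod>i = 0..<m. mat m m (\<lambda>(i, k). \<Sum>s\<in>S (Suc i). c (Suc i) s * f s k) $$ (i, p i)) =
        (\<Prod>i = 0..<m. \<Sum>s\<in>S (Suc i). c (Suc i) s * f s (p (Suc i - 1)))"
      using p by (intro prod.cong) auto
    also have "\<dots> = (\<Prod>i\<in>{1..m}. \<Sum>s\<in>S i. c i s * f s (p (i - 1)))"
      by (rule shift)
    also have "\<dots> = (\<Sum>\<sigma>\<in>Pi\<^sub>E {1..m} S. \<Prod>i\<in>{1..m}. c i (\<sigma> i) * f (\<sigma> i) (p (i - 1)))"
      using assms by (intro prod_sum_PiE) auto
    also have "\<dots> = (\<Sum>\<sigma>\<in>Pi\<^sub>E {1..m} S. (\<Prod>i\<in>{1..m}. c i (\<sigma> i)) *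
        (\<Prod>i = 0..<m. f (\<sigma> (Suc i)) (p (Suc i - 1))))"
      by (simp only: prod.distrib shift[of "\<lambda>i. f (\<sigma> i) (p (i - 1))" for \<sigma>])
    also have "\<dots> = (\<Sum>\<sigma>\<in>Pi\<^sub>E {1..m} S. (\<Prod>i\<in>{1..m}. c i (\<sigma> i)) *
        (\<Prod>i = 0..<m. mat m m (\<lambda>(i, k). f (\<sigma> (Suc i)) k) $$ (i, p i)))"
      using p by (intro sum.cong arg_cong2[of _ _ _ _ "(*)"] prod.cong) auto
    finally show ?thesis .
  qed
  let ?P = "{p. p permutes {0..<m}}"
  let ?C = "\<lambda>\<sigma>. \<Prod>i\<in>{1..m}. c i (\<sigma> i)"
  let ?A = "\<lambda>\<sigma>. mat m m (\<lambda>(i, k). f (\<sigma> (Suc i)) k)"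
  have "det (mat m m (\<lambda>(i, k). \<Sum>s\<in>S (Suc i). c (Suc i) s * f s k)) =
      (\<Sum>p\<in>?P. signof p * (\<Sum>\<sigma>\<in>Pi\<^sub>E {1..m} S. ?C \<sigma> * (\<Prod>i = 0..<m. ?A \<sigma> $$ (i, p i))))"
    by (subst det_def'[OF mat_carrier]) (rule sum.cong[OF refl], simp only: mem_Collect_eq expand)
  also have "\<dots> = (\<Sum>\<sigma>\<in>Pi\<^sub>E {1..m} S. \<Sum>p\<in>?P. signof p * (?C \<sigma> * (\<Prod>i = 0..<m. ?A \<sigma> $$ (i, p i))))"
    unfolding sum_distrib_left by (rule sum.swap)
  also have "\<dots> = (\<Sum>\<sigma>\<in>Pi\<^sub>E {1..m} S. ?C \<sigma> * det (?A \<sigma>))"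
    by (simp only: det_def'[OF mat_carrier] sum_distrib_left mult.left_commute)
  finally show ?thesis .
qed

section \<open>The polynomials $U_t$\<close>

context
  fixes x :: "int \<Rightarrow> 'a::comm_ring_1" and l :: 'a and n :: int
begin

text \<open>
  \<open>split_prod t t\<close> is $U_t$, and \<open>split_prod t (t + d)\<close> is what is left of it after the factors
  have been split off \<open>d\<close> times.
\<close>

definition split_prod :: "int \<Rightarrow> int \<Rightarrow> 'a poly" where
  "split_prod a b = (\<Prod>s\<in>{1..<a}. [:1, x s:]) * (\<Prod>s\<in>{b<..n}. [:1, - l * x s:])"

lemma coeff_split_prod_0: "coeff (split_prod a b) 0 = 1"
  by (simp add: split_prod_def poly_prod flip: poly_0_coeff_0)

text \<open>Raising \<open>a\<close> by one gains the factor 1 + z x_a; \<open>pCons 0\<close> is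
  multiplication by z.\<close>

lemma split_prod_Suc_left:
  assumes "1 \<le> a"
  shows "split_prod (a + 1) b = split_prod a b + pCons 0 (smult (x a) (split_prod a b))"
proof -
  have "{1..<a + 1} = insert a {1..<a}"
    using assms by auto
  then show ?thesis
    by (simp add: split_prod_def algebra_simps)
qed

text \<open>Raising \<open>b\<close> by one loses the factor 1 - l z x_(b+1).\<close>

lemma split_prod_Suc_right:
  assumes "b < n"
  shows "split_prod a b = split_prod a (b + 1) - pCons 0 (smult (l * x (b + 1)) (split_prod a (b + 1)))"
proof -
  have "{b<..n} = insert (b + 1) {b + 1<..n}"
    using assms by auto
  then show ?thesis
    by (simp add: split_prod_def algebra_simps)
qed

text \<open>Both products on the left are multiples of \<open>split_prod a (b + 1)\<close>, with
  cofactors 1 + z x_a and 1 - l z x_(b+1).\<close>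

lemma split_prod_shift:
  assumes "1 \<le> a" "b < n"
  shows "split_prod (a + 1) (b + 1) - split_prod a b = pCons 0 (smult (x a + l * x (b + 1)) (split_prod a (b + 1)))"
  unfolding split_prod_Suc_left[OF assms(1)] split_prod_Suc_right[OF assms(2)]
  by (rule poly_eqI) (simp add: coeff_pCons algebra_simps split: nat.split)

definition step_weight :: "int \<Rightarrow> int \<Rightarrow> int \<Rightarrow> 'a" where
  "step_weight a b s = (if s = b then l else if s = a then 1 else 1 + l)"

text \<open>Let W be \<open>split_prod b (b + 1)\<close>. Then U_(b+1) = (1 + z x_b) W and U_b = (1
  - l z x_(b+1)) W. In x_b U_b + l x_(b+1) U_(b+1) the cross terms cancel, which gives the case of
  adjacent indices. Summing these, an inner \<open>s\<close> ends one step and starts the next, so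
  its weight is l + 1.\<close>

lemma split_prod_diag_diff:
  assumes "1 \<le> a" "a < b" "b \<le> n"
  shows "split_prod b b - split_prod a a = pCons 0 (\<Sum>s\<in>{a..b}. smult (step_weight a b s * x s) (split_prod s s))"
  using \<open>a < b\<close> \<open>b \<le> n\<close>
proof (induction b rule: int_gr_induct)
  have adjacent: "split_prod (b + 1) (b + 1) - split_prod b b =
      pCons 0 (smult (x b) (split_prod b b) + smult (l * x (b + 1)) (split_prod (b + 1) (b + 1)))"
    if "a \<le> b" "b + 1 \<le> n" for b
  proof -
    have "split_prod (b + 1) (b + 1) = split_prod b (b + 1) + pCons 0 (smult (x b) (split_prod b (b + 1)))"
      using that assms(1) by (intro split_prod_Suc_left) simp
    moreover have "split_prod b b = split_prod b (b + 1) - pCons 0 (smult (l * x (b + 1)) (split_prod b (b + 1)))"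
      using that by (intro split_prod_Suc_right) simp
    ultimately show ?thesis
      by (simp only:) (rule poly_eqI, simp add: coeff_pCons algebra_simps split: nat.split)
  qed
  {
    case base
    have "{a..a + 1} = {a, a + 1}"
      by auto
    then show ?case
      using adjacent[of a] base by (simp add: step_weight_def)
  next
    case (step b)
    \<comment> \<open>From \<open>b\<close> to \<open>b + 1\<close>, the weight of \<open>b\<close>
      grows from \<open>l\<close> to \<open>1 + l\<close>, the new index gets \<open>l\<close>, and
      all others keep theirs.\<close>
    have "{a..b + 1} = insert (b + 1) (insert b {a..<b})" "{a..b} = insert b {a..<b}"
      using step by auto
    then have "smult (x b) (split_prod b b) + smult (l * x (b + 1)) (split_prod (b + 1) (b + 1))
          + (\<Sum>s\<in>{a..b}. smult (step_weight a b s * x s) (split_prod s s)) =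
        (\<Sum>s\<in>{a..b + 1}. smult (step_weight a (b + 1) s * x s) (split_prod s s))"
      using step.hyps
      by (simp add: step_weight_def algebra_simps smult_add_left cong: sum.cong_simp)
    moreover have "split_prod (b + 1) (b + 1) - split_prod a a =
        (split_prod (b + 1) (b + 1) - split_prod b b) + (split_prod b b - split_prod a a)"
      by simp
    ultimately show ?case
      using step adjacent[of b] by simp
  }
qed

lemma coeff_split_prod_diag_diff:
  assumes "1 \<le> a" "a < b" "b \<le> n"
  shows "coeff (split_prod b b) (Suc k) - coeff (split_prod a a) (Suc k) =
    (\<Sum>s\<in>{a..b}. step_weight a b s * x s * coeff (split_prod s s) k)"
  using arg_cong[OF split_prod_diag_diff[OF assms], of "\<lambda>p. coeff p (Suc k)"]
  by (simp add: coeff_sum)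

section \<open>Evaluation of the determinant for the bottom row 1, ..., n\<close>

text \<open>Taking differences of consecutive rows splits off one factor for each pair at distance
  \<open>d + 1\<close>. What remains is the same determinant with \<open>m\<close> lowered and
  \<open>d\<close> raised by one, so \<open>m + d\<close> stays equal to \<open>n\<close>.\<close>

lemma det_split_prod:
  assumes "int (m + d) = n"
  shows "det (mat m m (\<lambda>(i, k). coeff (split_prod (int (Suc i)) (int (Suc i + d))) k)) =
    (\<Prod>(i, j)\<in>{(i, j). 1 \<le> i \<and> i + d < j \<and> int j \<le> n}. x (int i) + l * x (int j))"
  using assms
proof (induction m arbitrary: d)
  case 0
  then have "{(i, j). 1 \<le> i \<and> i + d < j \<and> int j \<le> n} = {}"
    by auto
  then show ?case
    by (simp only: det_dim_zero[OF mat_carrier] prod.empty)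
next
  case (Suc m)
  let ?D = "{(i, j). 1 \<le> i \<and> i + Suc d < j \<and> int j \<le> n}"
  have diff: "coeff (split_prod (int (Suc (Suc i))) (int (Suc (Suc i) + d))) (Suc k)
      - coeff (split_prod (int (Suc i)) (int (Suc i + d))) (Suc k) =
      (x (int (Suc i)) + l * x (int (Suc i + Suc d)))
        * coeff (split_prod (int (Suc i)) (int (Suc i + Suc d))) k" if "i < m" for i k
    using that Suc.prems
      arg_cong[OF split_prod_shift[of "int (Suc i)" "int (Suc i + d)"], of "\<lambda>p. coeff p (Suc k)"]
    by (simp add: algebra_simps)
  have "det (mat (Suc m) (Suc m) (\<lambda>(i, k). coeff (split_prod (int (Suc i)) (int (Suc i + d))) k)) =
      det (mat m m (\<lambda>(i, k). coeff (split_prod (int (Suc (Suc i))) (int (Suc (Suc i) + d))) (Suc k)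
        - coeff (split_prod (int (Suc i)) (int (Suc i + d))) (Suc k)))"
    by (rule det_consecutive_row_differences) (rule coeff_split_prod_0)
  also have "\<dots> = det (mat m m (\<lambda>(i, k). (x (int (Suc i)) + l * x (int (Suc i + Suc d)))
        * coeff (split_prod (int (Suc i)) (int (Suc i + Suc d))) k))"
    by (intro arg_cong[of _ _ det] cong_mat) (simp_all only: diff split)
  also have "\<dots> = (\<Prod>i<m. x (int (Suc i)) + l * x (int (Suc i + Suc d)))
      * (\<Prod>(i, j)\<in>?D. x (int i) + l * x (int j))"
    by (subst det_scale_rows, subst Suc.IH) (use Suc.prems in simp_all)
  \<comment> \<open>The factors just split off are those of the diagonal j = i + d + 1; the
    induction hypothesis covers the pairs farther apart.\<close>
  also have "(\<Prod>i<m. x (int (Suc i)) + l * x (int (Suc i + Suc d))) =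
      (\<Prod>(i, j)\<in>(\<lambda>i. (Suc i, Suc i + Suc d)) ` {..<m}. x (int i) + l * x (int j))"
    by (subst prod.reindex) (auto simp: inj_on_def)
  also have "\<dots> * (\<Prod>(i, j)\<in>?D. x (int i) + l * x (int j)) =
      (\<Prod>(i, j)\<in>(\<lambda>i. (Suc i, Suc i + Suc d)) ` {..<m} \<union> ?D. x (int i) + l * x (int j))"
    by (rule prod.union_disjoint[symmetric])
      (auto intro: finite_subset[of _ "{..nat n} \<times> {..nat n}"])
  also have "(\<lambda>i. (Suc i, Suc i + Suc d)) ` {..<m} \<union> ?D =
      {(i, j). 1 \<le> i \<and> i + d < j \<and> int j \<le> n}"
  proof (intro Set.set_eqI)
    fix p :: "nat \<times> nat"
    obtain i j where p: "p = (i, j)"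
      by fastforce
    have "(i, j) \<in> (\<lambda>i. (Suc i, Suc i + Suc d)) ` {..<m} \<longleftrightarrow> 1 \<le> i \<and> i \<le> m \<and> j = i + Suc d"
      by (auto simp: image_iff intro: bexI[of _ "i - 1"])
    then show "p \<in> (\<lambda>i. (Suc i, Suc i + Suc d)) ` {..<m} \<union> ?D \<longleftrightarrow>
        p \<in> {(i, j). 1 \<le> i \<and> i + d < j \<and> int j \<le> n}"
      unfolding p Un_iff mem_Collect_eq prod.case using Suc.prems by presburger
  qed
  finally show ?case .
qed

end

section \<open>Monotone triangles\<close>

text \<open>Column 0 is the bottom row \<open>t\<close>. The premise \<open>1 \<le> i\<close> of the
  last condition keeps \<open>(i, j)\<close> inside the index set.\<close>

definition triangles :: "nat \<Rightarrow> (nat \<Rightarrow> int) \<Rightarrow> (nat \<times> nat \<Rightarrow> int) set" where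
  "triangles m t = {\<alpha> \<in> extensional (positions m).
     (\<forall>i\<in>{1..m}. \<alpha> (i, 0) = t i) \<and>
     (\<forall>i j. (i, Suc j) \<in> positions m \<longrightarrow> \<alpha> (i, j) \<le> \<alpha> (i, Suc j) \<and> \<alpha> (i, Suc j) \<le> \<alpha> (Suc i, j)) \<and>
     (\<forall>i j. 1 \<le> i \<and> (Suc i, j) \<in> positions m \<longrightarrow> \<alpha> (i, j) < \<alpha> (Suc i, j))}"

text \<open>These are the rows that can stand directly above a bottom row \<open>t\<close> of length
  \<open>m + 1\<close>. The box \<open>Pi\<^sub>E\<close> without strictness is the index set
  produced by \<open>det_sum_rows\<close>.\<close>

definition interlacing :: "nat \<Rightarrow> (nat \<Rightarrow> int) \<Rightarrow> (nat \<Rightarrow> int) set" where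
  "interlacing m t = {s \<in> Pi\<^sub>E {1..m} (\<lambda>i. {t i..t (Suc i)}). \<forall>i. 1 \<le> i \<and> i < m \<longrightarrow> s i < s (Suc i)}"

section \<open>Adding and removing the bottom row of a triangle\<close>

definition prepend_column :: "nat \<Rightarrow> (nat \<Rightarrow> int) \<Rightarrow> (nat \<times> nat \<Rightarrow> int) \<Rightarrow> nat \<times> nat \<Rightarrow> int" where
  "prepend_column m t \<beta> =
    restrict (\<lambda>(i, j). if j = 0 then t i else \<beta> (i, j - 1)) (positions (Suc m))"

definition drop_column :: "nat \<Rightarrow> (nat \<times> nat \<Rightarrow> int) \<Rightarrow> nat \<times> nat \<Rightarrow> int" where
  "drop_column m \<alpha> = restrict (\<lambda>(i, j). \<alpha> (i, Suc j)) (positions m)"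

lemma positions_simps:
  "(i, 0) \<in> positions m \<longleftrightarrow> i \<in> {1..m}"
  "(i, Suc j) \<in> positions (Suc m) \<longleftrightarrow> (i, j) \<in> positions m"
  by (auto simp: positions_def)

lemma positions_neighbours:
  assumes "(i, Suc j) \<in> positions m"
  shows "(i, j) \<in> positions m" "(Suc i, j) \<in> positions m"
  using assms by (auto simp: positions_def)

lemma positions_above:
  assumes "1 \<le> i" "(Suc i, j) \<in> positions m"
  shows "(i, j) \<in> positions m"
  using assms by (auto simp: positions_def)

lemma prepend_column_simps:
  "i \<in> {1..Suc m} \<Longrightarrow> prepend_column m t \<beta> (i, 0) = t i"
  "(i, j) \<in> positions m \<Longrightarrow> prepend_column m t \<beta> (i, Suc j) = \<beta> (i, j)"
  by (auto simp: prepend_column_def positions_simps)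

lemma triangles_0: "triangles 0 t = {\<lambda>_. undefined}"
proof -
  have "positions 0 = {}"
    by (auto simp: positions_def)
  then show ?thesis
    by (simp add: triangles_def)
qed

text \<open>Conditions between columns 0 and 1 come from \<open>interlacing\<close>, strictness in
  column 0 from \<open>t\<close>, and everything farther right from \<open>\<beta>\<close>.\<close>

lemma prepend_column_triangles:
  assumes t: "\<And>i. 1 \<le> i \<Longrightarrow> i \<le> m \<Longrightarrow> t i < t (Suc i)"
    and s: "s \<in> interlacing m t" and \<beta>: "\<beta> \<in> triangles m s"
  shows "prepend_column m t \<beta> \<in> triangles (Suc m) t"
proof -
  let ?\<alpha> = "prepend_column m t \<beta>"
  have interl: "?\<alpha> (i, j) \<le> ?\<alpha> (i, Suc j) \<and> ?\<alpha> (i, Suc j) \<le> ?\<alpha> (Suc i, j)"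
    if "(i, Suc j) \<in> positions (Suc m)" for i j
  proof (cases j)
    case 0
    then have "i \<in> {1..m}"
      using that by (simp add: positions_simps)
    moreover from this have "\<beta> (i, 0) = s i" "s i \<in> {t i..t (Suc i)}"
      using s \<beta> by (auto simp: triangles_def interlacing_def)
    ultimately show ?thesis
      using 0 by (simp add: prepend_column_simps positions_simps)
  next
    case (Suc j')
    then have pos: "(i, Suc j') \<in> positions m"
      using that by (simp add: positions_simps)
    then have "\<beta> (i, j') \<le> \<beta> (i, Suc j') \<and> \<beta> (i, Suc j') \<le> \<beta> (Suc i, j')"
      using \<beta> by (auto simp: triangles_def)
    then show ?thesis
      using Suc pos positions_neighbours[OF pos] by (simp add: prepend_column_simps)
  qed
  have strict: "?\<alpha> (i, j) < ?\<alpha> (Suc i, j)"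
    if "1 \<le> i" "(Suc i, j) \<in> positions (Suc m)" for i j
  proof (cases j)
    case 0
    then show ?thesis
      using that t[of i] by (simp add: prepend_column_simps positions_simps)
  next
    case (Suc j')
    then have pos: "(Suc i, j') \<in> positions m"
      using that by (simp add: positions_simps)
    then have "\<beta> (i, j') < \<beta> (Suc i, j')"
      using \<beta> that by (auto simp: triangles_def)
    then show ?thesis
      using Suc pos positions_above[OF that(1) pos] by (simp add: prepend_column_simps)
  qed
  show ?thesis
    using interl strict
    by (auto simp: triangles_def prepend_column_simps) (simp add: prepend_column_def)
qed

lemma drop_column_triangles:
  assumes "\<alpha> \<in> triangles (Suc m) t"
  shows "restrict (\<lambda>i. \<alpha> (i, 1)) {1..m} \<in> interlacing m t" (is ?thesis1)
    and "drop_column m \<alpha> \<in> triangles m (restrict (\<lambda>i. \<alpha> (i, 1)) {1..m})" (is ?thesis2)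
    and "prepend_column m t (drop_column m \<alpha>) = \<alpha>" (is ?thesis3)
proof -
  have ext: "\<alpha> \<in> extensional (positions (Suc m))"
    and col0: "\<And>i. i \<in> {1..Suc m} \<Longrightarrow> \<alpha> (i, 0) = t i"
    and interl: "\<And>i j. (i, j) \<in> positions m \<Longrightarrow>
      \<alpha> (i, j) \<le> \<alpha> (i, Suc j) \<and> \<alpha> (i, Suc j) \<le> \<alpha> (Suc i, j)"
    and strict: "\<And>i j. 1 \<le> i \<Longrightarrow> (Suc i, j) \<in> positions (Suc m) \<Longrightarrow> \<alpha> (i, j) < \<alpha> (Suc i, j)"
    using assms by (auto simp: triangles_def positions_simps)
  show ?thesis1
    using interl[of _ 0] strict[of _ 1] col0
    by (auto simp: interlacing_def positions_simps)
  have drop: "drop_column m \<alpha> (i, j) = \<alpha> (i, Suc j)" if "(i, j) \<in> positions m" for i j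
    using that by (simp add: drop_column_def)
  have "drop_column m \<alpha> (i, j) \<le> drop_column m \<alpha> (i, Suc j) \<and>
      drop_column m \<alpha> (i, Suc j) \<le> drop_column m \<alpha> (Suc i, j)" if "(i, Suc j) \<in> positions m" for i j
    using that interl[OF that] positions_neighbours[OF that] by (simp add: drop)
  moreover have "drop_column m \<alpha> (i, j) < drop_column m \<alpha> (Suc i, j)"
    if "1 \<le> i" "(Suc i, j) \<in> positions m" for i j
    using that strict[of i "Suc j"] positions_above[OF that] by (simp add: drop positions_simps)
  moreover have "drop_column m \<alpha> \<in> extensional (positions m)"
    by (simp add: drop_column_def)
  ultimately show ?thesis2
    by (simp add: triangles_def drop positions_simps)
  show ?thesis3
  proof (rule extensionalityI[OF _ ext])
    fix p assume p: "p \<in> positions (Suc m)"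
    obtain i j where "p = (i, j)"
      by fastforce
    with p col0 show "prepend_column m t (drop_column m \<alpha>) p = \<alpha> p"
      by (cases j) (auto simp: prepend_column_simps positions_simps drop_column_def)
  qed (simp add: prepend_column_def)
qed

text \<open>The recursion for triangles: above the bottom row \<open>t\<close> one chooses a row
  \<open>s\<close> and then a triangle with bottom row \<open>s\<close>. Column 1 of the result
  recovers \<open>s\<close>.\<close>

lemma bij_betw_prepend_column:
  assumes "\<And>i. 1 \<le> i \<Longrightarrow> i \<le> m \<Longrightarrow> t i < t (Suc i)"
  shows "bij_betw (\<lambda>(s, \<beta>). prepend_column m t \<beta>)
    (Sigma (interlacing m t) (triangles m)) (triangles (Suc m) t)"
proof (rule bij_betw_byWitness[where f' = "\<lambda>\<alpha>. (restrict (\<lambda>i. \<alpha> (i, 1)) {1..m}, drop_column m \<alpha>)"])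
  show "\<forall>a\<in>Sigma (interlacing m t) (triangles m).
      (restrict (\<lambda>i. (case a of (s, \<beta>) \<Rightarrow> prepend_column m t \<beta>) (i, 1)) {1..m},
        drop_column m (case a of (s, \<beta>) \<Rightarrow> prepend_column m t \<beta>)) = a"
  proof clarify
    fix s \<beta> assume s: "s \<in> interlacing m t" and \<beta>: "\<beta> \<in> triangles m s"
    have "restrict (\<lambda>i. prepend_column m t \<beta> (i, 1)) {1..m} = s"
      using s \<beta>
      by (intro extensionalityI[of _ "{1..m}"])
        (auto simp: prepend_column_simps positions_simps interlacing_def triangles_def PiE_def)
    moreover have "drop_column m (prepend_column m t \<beta>) = \<beta>"
      using \<beta> by (intro extensionalityI[of _ "positions m"])
        (auto simp: drop_column_def prepend_column_simps triangles_def)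
    ultimately show "restrict (\<lambda>i. prepend_column m t \<beta> (i, 1)) {1..m} = s \<and>
        drop_column m (prepend_column m t \<beta>) = \<beta>" ..
  qed
  show "\<forall>\<alpha>\<in>triangles (Suc m) t. (case (restrict (\<lambda>i. \<alpha> (i, 1)) {1..m}, drop_column m \<alpha>) of
      (s, \<beta>) \<Rightarrow> prepend_column m t \<beta>) = \<alpha>"
    by (simp add: drop_column_triangles(3))
  show "(\<lambda>(s, \<beta>). prepend_column m t \<beta>) ` Sigma (interlacing m t) (triangles m) \<subseteq> triangles (Suc m) t"
    by (auto intro: prepend_column_triangles assms)
  show "(\<lambda>\<alpha>. (restrict (\<lambda>i. \<alpha> (i, 1)) {1..m}, drop_column m \<alpha>)) ` triangles (Suc m) t
      \<subseteq> Sigma (interlacing m t) (triangles m)"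
    using drop_column_triangles(1,2) by blast
qed

lemma finite_interlacing: "finite (interlacing m t)"
  unfolding interlacing_def by (rule finite_subset[of _ "Pi\<^sub>E {1..m} (\<lambda>i. {t i..t (Suc i)})"])
    (auto intro: finite_PiE)

lemma finite_triangles:
  assumes "\<And>i. 1 \<le> i \<Longrightarrow> i < m \<Longrightarrow> t i < t (Suc i)"
  shows "finite (triangles m t)"
  using assms
proof (induction m arbitrary: t)
  case 0
  then show ?case
    by (simp add: triangles_0)
next
  case (Suc m)
  have "finite (triangles m s)" if "s \<in> interlacing m t" for s
    using that by (intro Suc.IH) (auto simp: interlacing_def)
  then have "finite (Sigma (interlacing m t) (triangles m))"
    using finite_interlacing by blast
  then show ?case
    using bij_betw_finite[OF bij_betw_prepend_column[of m t]] Suc.prems by simp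
qed

section \<open>Weights of triangles and their generating function\<close>

context
  fixes x :: "int \<Rightarrow> 'a::comm_ring_1" and l :: 'a
begin

text \<open>Column 0 contributes no factor, which is the source of the exponents
  \<open>C_stat n k \<alpha> - 1\<close>.\<close>

definition triangle_weight :: "nat \<Rightarrow> (nat \<times> nat \<Rightarrow> int) \<Rightarrow> 'a" where
  "triangle_weight m \<alpha> = (\<Prod>(i, j)\<in>{p \<in> positions m. 1 \<le> snd p}.
    step_weight l (\<alpha> (i, j - 1)) (\<alpha> (Suc i, j - 1)) (\<alpha> (i, j)) * x (\<alpha> (i, j)))"

text \<open>The factor of an entry involves only its own column and the one to its left. Hence
  column 1 gives the product over \<open>t\<close> and \<open>s\<close>, and the columns after it
  give the weight of \<open>\<beta>\<close>.\<close>

lemma triangle_weight_prepend_column: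
  assumes \<beta>: "\<beta> \<in> triangles m s"
  shows "triangle_weight (Suc m) (prepend_column m t \<beta>) =
    (\<Prod>i\<in>{1..m}. step_weight l (t i) (t (Suc i)) (s i) * x (s i)) * triangle_weight m \<beta>"
proof -
  let ?\<alpha> = "prepend_column m t \<beta>"
  \<comment> \<open>\<open>g i j\<close> is the factor of the position \<open>(i, Suc j)\<close>, so
    that the product runs over \<open>positions m\<close>.\<close>
  define g where "g i j = step_weight l (?\<alpha> (i, j)) (?\<alpha> (Suc i, j)) (?\<alpha> (i, Suc j)) * x (?\<alpha> (i, Suc j))"
    for i j
  have shift: "{p \<in> positions (Suc m). 1 \<le> snd p} = (\<lambda>(i, j). (i, Suc j)) ` positions m"
  proof (rule Set.set_eqI, simp only: split_paired_all)
    fix i j show "(i, j) \<in> {p \<in> positions (Suc m). 1 \<le> snd p} \<longleftrightarrow>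
        (i, j) \<in> (\<lambda>(i, j). (i, Suc j)) ` positions m"
      by (cases j) (force simp: positions_simps image_iff)+
  qed
  have split: "positions m = (\<lambda>i. (i, 0)) ` {1..m} \<union> {p \<in> positions m. 1 \<le> snd p}"
    by (auto simp: positions_def)
  have "triangle_weight (Suc m) ?\<alpha> = (\<Prod>(i, j)\<in>positions m. g i j)"
    unfolding triangle_weight_def shift
    by (subst prod.reindex) (auto simp: g_def inj_on_def intro!: prod.cong)
  also have "\<dots> = (\<Prod>i\<in>{1..m}. g i 0) * (\<Prod>(i, j)\<in>{p \<in> positions m. 1 \<le> snd p}. g i j)"
    by (subst split, subst prod.union_disjoint)
      (auto simp: prod.reindex inj_on_def finite_positions)
  also have "(\<Prod>i\<in>{1..m}. g i 0) =
      (\<Prod>i\<in>{1..m}. step_weight l (t i) (t (Suc i)) (s i) * x (s i))"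
    using \<beta> by (intro prod.cong)
      (auto simp: g_def prepend_column_simps positions_simps triangles_def)
  also have "(\<Prod>(i, j)\<in>{p \<in> positions m. 1 \<le> snd p}. g i j) = triangle_weight m \<beta>"
    unfolding triangle_weight_def
  proof (intro prod.cong refl, clarify)
    fix i j assume "(i, j) \<in> positions m" "1 \<le> snd (i, j)"
    moreover then obtain j' where "j = Suc j'"
      by (cases j) auto
    ultimately show "g i j = step_weight l (\<beta> (i, j - 1)) (\<beta> (Suc i, j - 1)) (\<beta> (i, j)) * x (\<beta> (i, j))"
      using positions_neighbours[of i j' m] by (simp add: g_def prepend_column_simps)
  qed
  finally show ?thesis .
qed

lemma sum_triangle_weight:
  assumes "\<And>i. i \<in> {1..m} \<Longrightarrow> t i \<in> {1..n}"
    and "\<And>i. 1 \<le> i \<Longrightarrow> i < m \<Longrightarrow> t i < t (Suc i)"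
  shows "(\<Sum>\<alpha>\<in>triangles m t. triangle_weight m \<alpha>) =
    det (mat m m (\<lambda>(i, k). coeff (split_prod x l n (t (Suc i)) (t (Suc i))) k))"
  using assms
proof (induction m arbitrary: t)
  case 0
  have "triangle_weight 0 \<alpha> = 1" for \<alpha>
    unfolding triangle_weight_def by (rule prod.neutral) (auto simp: positions_def)
  then show ?case
    by (simp add: triangles_0 det_dim_zero[OF mat_carrier])
next
  case (Suc m)
  let ?P = "Pi\<^sub>E {1..m} (\<lambda>i. {t i..t (Suc i)})"
  let ?w = "\<lambda>i s. step_weight l (t i) (t (Suc i)) s * x s"
  let ?c = "\<lambda>a k. coeff (split_prod x l n a a) k"
  let ?d = "\<lambda>s. det (mat m m (\<lambda>(i, k). ?c (s (Suc i)) k))"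
  have t: "t i < t (Suc i)" if "1 \<le> i" "i \<le> m" for i
    using Suc.prems(2) that by simp
  have bij: "bij_betw (\<lambda>(s, \<beta>). prepend_column m t \<beta>)
      (Sigma (interlacing m t) (triangles m)) (triangles (Suc m) t)"
    by (rule bij_betw_prepend_column) (rule t)
  have strict: "s i < s (Suc i)" if "s \<in> interlacing m t" "1 \<le> i" "i < m" for s i
    using that by (auto simp: interlacing_def)
  have fin: "finite (triangles m s)" if "s \<in> interlacing m t" for s
    by (rule finite_triangles) (rule strict[OF that])
  have IH: "(\<Sum>\<beta>\<in>triangles m s. triangle_weight m \<beta>) = ?d s" if s: "s \<in> interlacing m t" for s
  proof (rule Suc.IH)
    fix i assume "i \<in> {1..m}"
    then show "s i \<in> {1..n}"
      using s Suc.prems(1)[of i] Suc.prems(1)[of "Suc i"] by (fastforce simp: interlacing_def PiE_def Pi_def)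
  qed (rule strict[OF s])
  have "(\<Sum>\<alpha>\<in>triangles (Suc m) t. triangle_weight (Suc m) \<alpha>) =
      (\<Sum>(s, \<beta>)\<in>Sigma (interlacing m t) (triangles m). triangle_weight (Suc m) (prepend_column m t \<beta>))"
    using sum.reindex_bij_betw[OF bij, of "triangle_weight (Suc m)"]
    by (simp add: case_prod_unfold)
  also have "\<dots> = (\<Sum>s\<in>interlacing m t. \<Sum>\<beta>\<in>triangles m s. triangle_weight (Suc m) (prepend_column m t \<beta>))"
    using finite_interlacing fin by (intro sum.Sigma[symmetric]) auto
  also have "\<dots> = (\<Sum>s\<in>interlacing m t. (\<Prod>i\<in>{1..m}. ?w i (s i)) * ?d s)"
    by (simp add: triangle_weight_prepend_column IH flip: sum_distrib_left)
  \<comment> \<open>Enlarging the sum to the whole box makes multilinearity applicable; each added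
    \<open>s\<close> repeats an entry and has a determinant with two equal rows.\<close>
  also have "\<dots> = (\<Sum>s\<in>?P. (\<Prod>i\<in>{1..m}. ?w i (s i)) * ?d s)"
  proof (rule sum.mono_neutral_left)
    show "\<forall>s\<in>?P - interlacing m t. (\<Prod>i\<in>{1..m}. ?w i (s i)) * ?d s = 0"
    proof
      fix s assume "s \<in> ?P - interlacing m t"
      then obtain i where s: "s \<in> ?P" and i: "1 \<le> i" "i < m" "s (Suc i) \<le> s i"
        by (auto simp: interlacing_def not_less)
      \<comment> \<open>The two intervals share only the point \<open>t (Suc i)\<close>, so a
        failure of strict increase forces equality.\<close>
      have "s i \<in> {t i..t (Suc i)}" "s (Suc i) \<in> {t (Suc i)..t (Suc (Suc i))}"
        using s i by (auto dest: PiE_mem)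
      then have "s i = s (Suc i)"
        using i by simp
      then have "?d s = 0"
        using i by (intro det_identical_rows[OF mat_carrier, of "i - 1" i]) auto
      then show "(\<Prod>i\<in>{1..m}. ?w i (s i)) * ?d s = 0"
        by simp
    qed
  qed (auto simp: interlacing_def intro: finite_PiE)
  also have "\<dots> = det (mat m m (\<lambda>(i, k). \<Sum>s\<in>{t (Suc i)..t (Suc (Suc i))}. ?w (Suc i) s * ?c s k))"
    by (rule det_sum_rows[symmetric]) simp
  \<comment> \<open>Each weighted row sum is the telescoped difference of two polynomials U_t, with
    the factor z absorbed by the shift to \<open>Suc k\<close>.\<close>
  also have "\<dots> = det (mat m m (\<lambda>(i, k). ?c (t (Suc (Suc i))) (Suc k) - ?c (t (Suc i)) (Suc k)))"
    using Suc.prems(1) t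
    by (intro arg_cong[of _ _ det] cong_mat) (auto simp: coeff_split_prod_diag_diff)
  also have "\<dots> = det (mat (Suc m) (Suc m) (\<lambda>(i, k). ?c (t (Suc i)) k))"
    by (rule det_consecutive_row_differences[symmetric]) (rule coeff_split_prod_0)
  finally show ?case .
qed

end

section \<open>The generating function of $Y_n^+$\<close>

text \<open>The range condition of \<open>Yplus\<close> follows from interlacing by induction on the
  column: an entry in column j + 1 is at least its west neighbor, hence at least i, and at most its
  southwest neighbor, hence at most i + 1 + j.\<close>

lemma Yplus_eq_triangles: "Yplus n = triangles n int"
proof (intro equalityI subsetI)
  fix \<alpha> assume "\<alpha> \<in> Yplus n"
  then have ext: "\<alpha> \<in> extensional (positions n)"
    and col0: "\<And>i. (i, 0) \<in> positions n \<Longrightarrow> \<alpha> (i, 0) = int i"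
    and strict: "\<And>i j. (i, j) \<in> positions n \<Longrightarrow> (i + 1, j) \<in> positions n \<Longrightarrow> \<alpha> (i, j) < \<alpha> (i + 1, j)"
    and west: "\<And>i j. (i, j) \<in> positions n \<Longrightarrow> (i, j + 1) \<in> positions n \<Longrightarrow> \<alpha> (i, j) \<le> \<alpha> (i, j + 1)"
    and southwest: "\<And>i j. (i, j) \<in> positions n \<Longrightarrow> 1 \<le> j \<Longrightarrow> (i + 1, j - 1) \<in> positions n \<Longrightarrow>
      \<alpha> (i, j) \<le> \<alpha> (i + 1, j - 1)"
    unfolding Yplus_def by blast+
  have "\<alpha> (i, j) \<le> \<alpha> (i, Suc j) \<and> \<alpha> (i, Suc j) \<le> \<alpha> (Suc i, j)" if "(i, Suc j) \<in> positions n" for i j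
    using that west[of i j] southwest[of i "Suc j"] positions_neighbours[OF that] by simp
  moreover have "\<alpha> (i, j) < \<alpha> (Suc i, j)" if "1 \<le> i" "(Suc i, j) \<in> positions n" for i j
    using that strict[of i j] positions_above[OF that] by simp
  ultimately show "\<alpha> \<in> triangles n int"
    using ext col0 by (simp add: triangles_def positions_simps)
next
  fix \<alpha> assume "\<alpha> \<in> triangles n int"
  then have ext: "\<alpha> \<in> extensional (positions n)"
    and col0: "\<And>i. i \<in> {1..n} \<Longrightarrow> \<alpha> (i, 0) = int i"
    and interl: "\<And>i j. (i, Suc j) \<in> positions n \<Longrightarrow>
      \<alpha> (i, j) \<le> \<alpha> (i, Suc j) \<and> \<alpha> (i, Suc j) \<le> \<alpha> (Suc i, j)"
    and strict: "\<And>i j. 1 \<le> i \<Longrightarrow> (Suc i, j) \<in> positions n \<Longrightarrow> \<alpha> (i, j) < \<alpha> (Suc i, j)"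
    by (auto simp: triangles_def)
  have range: "int i \<le> \<alpha> (i, j) \<and> \<alpha> (i, j) \<le> int (i + j)" if "(i, j) \<in> positions n" for i j
    using that
  proof (induction j arbitrary: i)
    case 0
    then show ?case
      using col0[of i] by (simp add: positions_simps)
  next
    case (Suc j)
    show ?case
      using interl[OF Suc.prems] Suc.IH[OF positions_neighbours(1)[OF Suc.prems]]
        Suc.IH[OF positions_neighbours(2)[OF Suc.prems]] by simp
  qed
  have southwest: "\<alpha> (i, j) \<le> \<alpha> (i + 1, j - 1)" if "(i, j) \<in> positions n" "1 \<le> j" for i j
    using that interl[of i "j - 1"] by simp
  have west: "\<alpha> (i, j) \<le> \<alpha> (i, j + 1)" if "(i, j + 1) \<in> positions n" for i j
    using that interl[of i j] by simp
  have pos: "1 \<le> i" if "(i, j) \<in> positions n" for i j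
    using that by (simp add: positions_def)
  show "\<alpha> \<in> Yplus n"
    unfolding Yplus_def using ext col0 range southwest west strict pos
    by (auto simp: positions_simps)
qed

text \<open>An entry outside column 0 equals its southwest neighbor (weight \<open>lam\<close>),
  lies strictly between its neighbors (weight \<open>1 + lam\<close>), or equals only its west
  neighbor (weight 1). Collecting equal factors gives the powers.\<close>

lemma triangle_weight_Yplus:
  assumes "\<alpha> \<in> Yplus n"
  shows "triangle_weight (\<lambda>s. xvar (nat s)) lam n \<alpha> =
    lam ^ E_stat n \<alpha> * (1 + lam) ^ N_stat n \<alpha> * (\<Prod>k = 1..n. xvar k ^ (C_stat n k \<alpha> - 1))"
proof -
  let ?P = "{p \<in> positions n. 1 \<le> snd p}"
  let ?E = "\<lambda>(i, j). \<alpha> (i, j) = \<alpha> (i + 1, j - 1)"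
  let ?N = "\<lambda>(i, j). \<alpha> (i, j - 1) < \<alpha> (i, j) \<and> \<alpha> (i, j) < \<alpha> (i + 1, j - 1)"
  have fin: "finite ?P"
    using finite_positions by simp
  have bounds: "\<alpha> (i, j - 1) \<le> \<alpha> (i, j)" "\<alpha> (i, j) \<le> \<alpha> (Suc i, j - 1)"
    if "(i, j) \<in> positions n" "1 \<le> j" for i j
  proof -
    have "(i, Suc (j - 1)) \<in> positions n"
      using that by simp
    then have "\<alpha> (i, j - 1) \<le> \<alpha> (i, Suc (j - 1)) \<and> \<alpha> (i, Suc (j - 1)) \<le> \<alpha> (Suc i, j - 1)"
      using assms unfolding Yplus_eq_triangles triangles_def by blast
    then show "\<alpha> (i, j - 1) \<le> \<alpha> (i, j)" "\<alpha> (i, j) \<le> \<alpha> (Suc i, j - 1)"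
      using that by simp_all
  qed
  have "triangle_weight (\<lambda>s. xvar (nat s)) lam n \<alpha> =
      (\<Prod>p\<in>?P. (if ?E p then lam else 1) * (if ?N p then 1 + lam else 1) * xvar (nat (\<alpha> p)))"
    unfolding triangle_weight_def
  proof (rule prod.cong[OF refl])
    fix p assume "p \<in> ?P"
    moreover obtain i j where "p = (i, j)"
      by fastforce
    ultimately show "(case p of (i, j) \<Rightarrow>
          step_weight lam (\<alpha> (i, j - 1)) (\<alpha> (Suc i, j - 1)) (\<alpha> (i, j)) * xvar (nat (\<alpha> (i, j)))) =
        (if ?E p then lam else 1) * (if ?N p then 1 + lam else 1) * xvar (nat (\<alpha> p))"
      using bounds[of i j] by (auto simp: step_weight_def)
  qed
  also have "\<dots> = (\<Prod>p\<in>?P. if ?E p then lam else 1) * (\<Prod>p\<in>?P. if ?N p then 1 + lam else 1)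
      * (\<Prod>p\<in>?P. xvar (nat (\<alpha> p)))"
    by (simp only: prod.distrib)
  also have "(\<Prod>p\<in>?P. if ?E p then lam else 1) = lam ^ card {p \<in> ?P. ?E p}"
    by (simp only: prod.inter_filter[OF fin, symmetric] prod_constant)
  also have "{p \<in> ?P. ?E p} = {(i, j). (i, j) \<in> positions n \<and> 1 \<le> j \<and> \<alpha> (i, j) = \<alpha> (i + 1, j - 1)}"
    by auto
  also have "(\<Prod>p\<in>?P. if ?N p then 1 + lam else 1) = (1 + lam) ^ card {p \<in> ?P. ?N p}"
    by (simp only: prod.inter_filter[OF fin, symmetric] prod_constant)
  also have "{p \<in> ?P. ?N p} = {(i, j). (i, j) \<in> positions n \<and> 1 \<le> j \<and>
      \<alpha> (i, j - 1) < \<alpha> (i, j) \<and> \<alpha> (i, j) < \<alpha> (i + 1, j - 1)}"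
    by auto
  \<comment> \<open>The entries are grouped by their value, which lies in
    \<open>{1..n}\<close>.\<close>
  also have "(\<Prod>p\<in>?P. xvar (nat (\<alpha> p))) =
      (\<Prod>k = 1..n. \<Prod>p\<in>{p \<in> ?P. nat (\<alpha> p) = k}. xvar (nat (\<alpha> p)))"
  proof (rule prod.group[symmetric, OF fin])
    show "(\<lambda>p. nat (\<alpha> p)) ` ?P \<subseteq> {1..n}"
    proof clarify
      fix i j assume pos: "(i, j) \<in> positions n"
      then have "int i \<le> \<alpha> (i, j) \<and> \<alpha> (i, j) \<le> int (i + j)"
        using assms unfolding Yplus_def by blast
      then show "nat (\<alpha> (i, j)) \<in> {1..n}"
        using pos by (auto simp: positions_def)
    qed
  qed simp
  also have "\<dots> = (\<Prod>k = 1..n. xvar k ^ (C_stat n k \<alpha> - 1))"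
  proof (rule prod.cong[OF refl])
    fix k assume k: "k \<in> {1..n}"
    have col0: "\<alpha> (i, 0) = int i" if "(i, 0) \<in> positions n" for i
      using assms that unfolding Yplus_def by blast
    \<comment> \<open>Column 0 contains the value \<open>k\<close> exactly once, at
      \<open>(k, 0)\<close>; removing it lowers the count by one.\<close>
    have "{p \<in> positions n. \<alpha> p = int k} = insert (k, 0) {p \<in> ?P. nat (\<alpha> p) = k}"
    proof (rule Set.set_eqI, simp only: split_paired_all)
      fix i j
      show "(i, j) \<in> {p \<in> positions n. \<alpha> p = int k} \<longleftrightarrow>
          (i, j) \<in> insert (k, 0) {p \<in> ?P. nat (\<alpha> p) = k}"
        using k col0 by (cases j) (auto simp: positions_simps)
    qed
    moreover have "finite {p \<in> ?P. nat (\<alpha> p) = k}"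
      by (rule finite_subset[OF _ fin]) auto
    ultimately have "C_stat n k \<alpha> - 1 = card {p \<in> ?P. nat (\<alpha> p) = k}"
      by (simp add: C_stat_def)
    then show "(\<Prod>p\<in>{p \<in> ?P. nat (\<alpha> p) = k}. xvar (nat (\<alpha> p))) = xvar k ^ (C_stat n k \<alpha> - 1)"
      by simp
  qed
  finally show ?thesis
    by (simp only: E_stat_def N_stat_def)
qed

theorem theorem6p2:
  fixes n :: nat
  assumes "n \<ge> 1"
  shows "(\<Prod>(i, j) \<in> {(i, j). 1 \<le> i \<and> i < j \<and> j \<le> n}. xvar i + lam * xvar j) =
    (\<Sum>\<alpha> \<in> Yplus n. lam ^ E_stat n \<alpha> * (1 + lam) ^ N_stat n \<alpha>
        * (\<Prod>k = 1..n. xvar k ^ (C_stat n k \<alpha> - 1)))"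
proof -
  let ?x = "\<lambda>s. xvar (nat s)"
  have "(\<Sum>\<alpha> \<in> Yplus n. lam ^ E_stat n \<alpha> * (1 + lam) ^ N_stat n \<alpha>
        * (\<Prod>k = 1..n. xvar k ^ (C_stat n k \<alpha> - 1))) =
      (\<Sum>\<alpha>\<in>Yplus n. triangle_weight ?x lam n \<alpha>)"
    by (simp only: triangle_weight_Yplus cong: sum.cong)
  also have "\<dots> = det (mat n n (\<lambda>(i, k). coeff (split_prod ?x lam (int n) (int (Suc i)) (int (Suc i))) k))"
    unfolding Yplus_eq_triangles by (rule sum_triangle_weight) auto
  also have "\<dots> = (\<Prod>(i, j) \<in> {(i, j). 1 \<le> i \<and> i < j \<and> j \<le> n}. xvar i + lam * xvar j)"
    \<comment> \<open>With \<open>d = 0\<close> nothing has been split off yet, and the pairs are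
      all i < j.\<close>
    using det_split_prod[of n 0 "int n" ?x lam] by simp
  finally show ?thesis ..
qed

end
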